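(* Let $\nabla$ be an $h$-connection of $E$ and $\varepsilon\in\{+,-\}$. Suppose $\{\mathrm{ord}(C_{\varepsilon,1}),\mathrm{ord}(C_{\varepsilon,2})\}=\{2,\infty\}$ and $\phi_\varepsilon\in(0,\pi/2)$. Then the topological holonomy group $G_{\hat\nabla,\varepsilon}$ has a noncommutative pair $(\hat C_1,\hat C_2)$ (elements $\hat C_1,\hat C_2\in G_{\hat\nabla,\varepsilon}$ with $\hat C_1\hat C_2\ne\hat C_2\hat C_1$) with $\infty=\mathrm{ord}(\hat C_1)\ge\mathrm{ord}(\hat C_2)\ge3$.
   Context: Let $T^2=S^1\times S^1$ with $S^1=\mathbb{R}/2\pi\mathbb{Z}$ and let $\mathrm{pr}:\mathbb{R}^2\to T^2$ be the projection. $E$ is an oriented real vector bundle of rank 4 over $T^2$ with a positive-definite metric $h$. An $h$-connection is a connection $\nabla$ of $E$ with $\nabla h=0$. $\bigwedge^2E$ with the induced metric $\hat h$ decomposes into rank 3 subbundles $\bigwedge^2_+E\oplus\bigwedge^2_-E$: for a local positively oriented orthonormal frame $(e_1,e_2,e_3,e_4)$ of $E$, $\bigwedge^2_\pm E$ has the local orthonormal frame $\Omega_{\pm,1}=\frac1{\sqrt2}(e_1\wedge e_2\pm e_3\wedge e_4)$, $\Omega_{\pm,2}=\frac1{\sqrt2}(e_1\wedge e_3\pm e_4\wedge e_2)$, $\Omega_{\pm,3}=\frac1{\sqrt2}(e_1\wedge e_4\pm e_2\wedge e_3)$, and is oriented by it. $\nabla$ induces an $\hat h$-connection $\hat\nabla$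 of $\bigwedge^2E$, which restricts to $\bigwedge^2_\pm E$. For $\varepsilon\in\{+,-\}$ fix a positively oriented orthonormal basis $(\omega_{\varepsilon,1},\omega_{\varepsilon,2},\omega_{\varepsilon,3})$ of the fiber of $\bigwedge^2_\varepsilon E$ at $\mathrm{pr}(0,0)$. Let $\tilde\Omega_{\varepsilon,i,x}$ (resp. $\tilde\Omega_{\varepsilon,i,y}$) be the $\hat\nabla$-parallel sections of $\mathrm{pr}^*\bigwedge^2_\varepsilon E$ along the $x$-axis (resp. $y$-axis) with value $\omega_{\varepsilon,i}$ at $(0,0)$. Identifying the fibers of the pull-back at $(x+2\pi m,y+2\pi n)$ and $(x,y)$ for $m,n\in\mathbb{Z}$, there are $C_{\varepsilon,1},C_{\varepsilon,2}\in SO(3)$ such that for all $a,b\in\mathbb{R}$: $(\tilde\Omega_{\varepsilon,i,x}(a+2\pi,0))_{i=1,2,3}=(\tilde\Omega_{\varepsilon,i,x}(a,0))_{i=1,2,3}\,C_{\varepsilon,1}$ and $(\tilde\Omega_{\varepsilon,i,y}(0,b+2\pi))_{i=1,2,3}=(\tilde\Omega_{\varepsilon,i,y}(0,b))_{i=1,2,3}\,C_{\varepsilon,2}$ (row vectors times matrices). The topological holonomy group $G_{\hat\nabla,\varepsilon}$ is the subgroup of $SO(3)$ generated by $C_{\varepsilon,1},C_{\varepsilon,2}$. For $C_{\varepsilon,1},C_{\varepsilon,2}$ different from the identity, $\phi_\varepsilon\in[0,\pi/2]$ denotes the angle between their rotation axes (the eigenspaces for the eigenvalue $1$). $\mathrm{ord}$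 denotes the order of a group element, in $\mathbb{N}\cup\{\infty\}$. *)

theory Defs
  imports
    "HOL-Analysis.Analysis"
    "HOL-Algebra.Generated_Groups"
    "HOL-Algebra.Multiplicative_Group"
    "HOL-Library.Extended_Nat"
begin

section \<open>Smooth functions\<close>

text \<open>These notions are only applied to open sets \<open>S\<close>.\<close>

primrec Ck_on :: "nat \<Rightarrow> ('a::euclidean_space) set \<Rightarrow> ('a \<Rightarrow> 'b::real_normed_vector) \<Rightarrow> bool" where
  "Ck_on 0 S f \<longleftrightarrow> continuous_on S f"
| "Ck_on (Suc k) S f \<longleftrightarrow>
     f differentiable_on S \<and> (\<forall>v. Ck_on k S (\<lambda>x. frechet_derivative f (at x) v))"

definition smooth_on :: "('a::euclidean_space) set \<Rightarrow> ('a \<Rightarrow> 'b::real_normed_vector) \<Rightarrow> bool" where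
  "smooth_on S f \<longleftrightarrow> (\<forall>k. Ck_on k S f)"


section \<open>The torus\<close>

definition circle_rel :: "real \<Rightarrow> real \<Rightarrow> bool" where
  "circle_rel x y \<longleftrightarrow> (\<exists>k::int. y = x + 2 * pi * of_int k)"

quotient_type circle = real / circle_rel
proof (rule equivpI)
  show "reflp circle_rel"
    unfolding reflp_def circle_rel_def by (metis add.right_neutral mult_zero_right of_int_0)
  show "symp circle_rel"
    unfolding symp_def circle_rel_def
  proof (intro allI impI, elim exE)
    fix x y :: real and k :: int
    assume "y = x + 2 * pi * of_int k"
    then show "\<exists>k::int. x = y + 2 * pi * of_int k"
      by (intro exI[of _ "- k"]) simp
  qed
  show "transp circle_rel"
    unfolding transp_def circle_rel_def
  proof (intro allI impI, elim exE)
    fix x y z :: real and k l :: int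
    assume "y = x + 2 * pi * of_int k" "z = y + 2 * pi * of_int l"
    then show "\<exists>k::int. z = x + 2 * pi * of_int k"
      by (intro exI[of _ "k + l"]) (simp add: algebra_simps)
  qed
qed

instantiation circle :: topological_space
begin

definition open_circle :: "circle set \<Rightarrow> bool" where
  "open_circle U \<longleftrightarrow> open (abs_circle -` U)"

instance
  by standard (auto simp: open_circle_def vimage_Int vimage_Union)

end

type_synonym torus = "circle \<times> circle"

definition pr :: "real \<times> real \<Rightarrow> torus" where
  "pr z = (abs_circle (fst z), abs_circle (snd z))"

text \<open>As \<open>pr\<close> is a local diffeomorphism, smoothness on the torus is smoothness of the
  composition with \<open>pr\<close>. By means of the coordinate vector fields, tangent vectors of the torus
  are elements of \<open>real \<times> real\<close>.\<close>

definition torus_smooth_on :: "torus set \<Rightarrow> (torus \<Rightarrow> real) \<Rightarrow> bool" where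
  "torus_smooth_on U f \<longleftrightarrow> smooth_on (pr -` U) (f \<circ> pr)"


section \<open>Vector bundles over the torus\<close>

text \<open>The fibers are subspaces of an arbitrary real vector space \<open>'v\<close> which carries no topology
  and only serves to house the sets of vectors; they need not be disjoint, and \<open>'v\<close> may be
  infinite-dimensional (for an abstract bundle, e.g. the direct sum of all fibers). The smooth
  structure is given by local trivializations, that is by local frames: \<open>(U, e)\<close> with \<open>U\<close> open
  and \<open>e i p\<close>, for \<open>i\<close> in the index set \<open>idx\<close>, a basis of the fiber at \<open>p \<in> U\<close>, the transition
  functions being smooth.\<close>

record ('i, 'v) vbundle =
  fib :: "torus \<Rightarrow> 'v set"
  idx :: "'i set"
  frames :: "(torus set \<times> ('i \<Rightarrow> torus \<Rightarrow> 'v)) set"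

definition smooth_section ::
  "('i, 'v::real_vector) vbundle \<Rightarrow> torus set \<Rightarrow> (torus \<Rightarrow> 'v) \<Rightarrow> bool" where
  "smooth_section E U s \<longleftrightarrow>
     (\<forall>p\<in>U. s p \<in> fib E p) \<and>
     (\<forall>(V, e)\<in>frames E. \<exists>c. (\<forall>i\<in>idx E. torus_smooth_on (U \<inter> V) (c i)) \<and>
        (\<forall>p\<in>U \<inter> V. s p = (\<Sum>i\<in>idx E. c i p *\<^sub>R e i p)))"

definition vector_bundle :: "('i, 'v::real_vector) vbundle \<Rightarrow> bool" where
  "vector_bundle E \<longleftrightarrow>
     finite (idx E) \<and>
     (\<forall>p. subspace (fib E p)) \<and>
     (\<forall>p. \<exists>(U, e)\<in>frames E. p \<in> U) \<and>
     (\<forall>(U, e)\<in>frames E. open U \<and>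
        (\<forall>p\<in>U. inj_on (\<lambda>i. e i p) (idx E) \<and> independent ((\<lambda>i. e i p) ` idx E) \<and>
               span ((\<lambda>i. e i p) ` idx E) = fib E p) \<and>
        (\<forall>i\<in>idx E. smooth_section E U (e i)))"

definition same_orientation ::
  "('i::finite \<Rightarrow> 'v::real_vector) \<Rightarrow> ('i \<Rightarrow> 'v) \<Rightarrow> bool" where
  "same_orientation b b' \<longleftrightarrow>
     (\<exists>A::real^'i^'i. det A > 0 \<and> (\<forall>j. b j = (\<Sum>i\<in>UNIV. A $ i $ j *\<^sub>R b' i)))"

text \<open>An orientation is given by the frames themselves, which are required to be positively
  oriented relative to each other. The rank is \<open>CARD('i)\<close>.\<close>

definition oriented_vector_bundle :: "('i::finite, 'v::real_vector) vbundle \<Rightarrow> bool" where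
  "oriented_vector_bundle E \<longleftrightarrow>
     vector_bundle E \<and> idx E = UNIV \<and>
     (\<forall>(U, e)\<in>frames E. \<forall>(V, f)\<in>frames E. \<forall>p\<in>U \<inter> V.
        same_orientation (\<lambda>i. e i p) (\<lambda>i. f i p))"

definition bundle_metric ::
  "('i, 'v::real_vector) vbundle \<Rightarrow> (torus \<Rightarrow> 'v \<Rightarrow> 'v \<Rightarrow> real) \<Rightarrow> bool" where
  "bundle_metric E h \<longleftrightarrow>
     (\<forall>p. \<forall>u\<in>fib E p. \<forall>v\<in>fib E p.
        h p u v = h p v u \<and>
        (\<forall>w\<in>fib E p. h p (u + v) w = h p u w + h p v w) \<and>
        (\<forall>c. h p (c *\<^sub>R u) v = c * h p u v) \<and>
        (u \<noteq> 0 \<longrightarrow> h p u u > 0)) \<and>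
     (\<forall>(U, e)\<in>frames E. \<forall>i\<in>idx E. \<forall>j\<in>idx E.
        torus_smooth_on U (\<lambda>p. h p (e i p) (e j p)))"

definition oriented_orthonormal_basis ::
  "('i::finite, 'v::real_vector) vbundle \<Rightarrow> (torus \<Rightarrow> 'v \<Rightarrow> 'v \<Rightarrow> real) \<Rightarrow> torus \<Rightarrow>
     ('i \<Rightarrow> 'v) \<Rightarrow> bool" where
  "oriented_orthonormal_basis E h p b \<longleftrightarrow>
     (\<forall>i. b i \<in> fib E p) \<and>
     (\<forall>i j. h p (b i) (b j) = of_bool (i = j)) \<and>
     (\<forall>(U, e)\<in>frames E. p \<in> U \<longrightarrow> same_orientation b (\<lambda>i. e i p))"

definition oriented_orthonormal_frame ::
  "('i::finite, 'v::real_vector) vbundle \<Rightarrow> (torus \<Rightarrow> 'v \<Rightarrow> 'v \<Rightarrow> real) \<Rightarrow> torus set \<Rightarrow>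
     ('i \<Rightarrow> torus \<Rightarrow> 'v) \<Rightarrow> bool" where
  "oriented_orthonormal_frame E h U e \<longleftrightarrow>
     open U \<and> (\<forall>i. smooth_section E U (e i)) \<and>
     (\<forall>p\<in>U. oriented_orthonormal_basis E h p (\<lambda>i. e i p))"


section \<open>Connections\<close>

text \<open>\<open>D s p w\<close> is the covariant derivative of \<open>s\<close> at \<open>p\<close> in the direction \<open>w\<close>. The operator acts
  on local sections (as a morphism of sheaves); the values of \<open>s\<close> outside of the open set on
  which it is a section do not matter. Homogeneity for real constants is contained in the
  Leibniz rule.\<close>

definition connection ::
  "('i, 'v::real_vector) vbundle \<Rightarrow> ((torus \<Rightarrow> 'v) \<Rightarrow> torus \<Rightarrow> real \<times> real \<Rightarrow> 'v) \<Rightarrow> bool" where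
  "connection E D \<longleftrightarrow>
     (\<forall>U s. open U \<and> smooth_section E U s \<longrightarrow>
        (\<forall>p\<in>U. linear (D s p)) \<and>
        (\<forall>w. smooth_section E U (\<lambda>p. D s p w))) \<and>
     (\<forall>U s t. open U \<and> smooth_section E U s \<and> smooth_section E U t \<longrightarrow>
        (\<forall>p\<in>U. \<forall>w. D (\<lambda>q. s q + t q) p w = D s p w + D t p w) \<and>
        ((\<forall>p\<in>U. s p = t p) \<longrightarrow> (\<forall>p\<in>U. D s p = D t p))) \<and>
     (\<forall>U f s. open U \<and> torus_smooth_on U f \<and> smooth_section E U s \<longrightarrow>
        (\<forall>z w. pr z \<in> U \<longrightarrow>
           D (\<lambda>q. f q *\<^sub>R s q) (pr z) w =
             frechet_derivative (f \<circ> pr) (at z) w *\<^sub>R s (pr z) + f (pr z) *\<^sub>R D s (pr z) w))"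

definition metric_connection ::
  "('i, 'v::real_vector) vbundle \<Rightarrow> (torus \<Rightarrow> 'v \<Rightarrow> 'v \<Rightarrow> real) \<Rightarrow>
     ((torus \<Rightarrow> 'v) \<Rightarrow> torus \<Rightarrow> real \<times> real \<Rightarrow> 'v) \<Rightarrow> bool" where
  "metric_connection E h D \<longleftrightarrow>
     connection E D \<and>
     (\<forall>U s t. open U \<and> smooth_section E U s \<and> smooth_section E U t \<longrightarrow>
        (\<forall>z w. pr z \<in> U \<longrightarrow>
           frechet_derivative (\<lambda>y. h (pr y) (s (pr y)) (t (pr y))) (at z) w =
             h (pr z) (D s (pr z) w) (t (pr z)) + h (pr z) (s (pr z)) (D t (pr z) w)))"

text \<open>\<open>\<gamma>\<close> is a curve in the plane and \<open>\<xi>\<close> a section along \<open>\<gamma>\<close> of the pull-back of \<open>F\<close> by \<open>pr\<close>,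
  whose fiber at \<open>z\<close> is \<open>fib F (pr z)\<close>; hence fibers of the pull-back at points that differ by a
  period are the same set. With respect to a local frame \<open>e\<close>, the covariant derivative of
  \<open>\<xi> = \<Sum>i. f i \<cdot> e i\<close> along \<open>\<gamma>\<close> is \<open>\<Sum>i. f i' \<cdot> e i + f i \<cdot> D (e i) \<gamma>'\<close>.\<close>

definition parallel_along ::
  "('i, 'v::real_vector) vbundle \<Rightarrow> ((torus \<Rightarrow> 'v) \<Rightarrow> torus \<Rightarrow> real \<times> real \<Rightarrow> 'v) \<Rightarrow>
     (real \<Rightarrow> real \<times> real) \<Rightarrow> (real \<Rightarrow> 'v) \<Rightarrow> bool" where
  "parallel_along F D \<gamma> \<xi> \<longleftrightarrow>
     (\<forall>t. \<xi> t \<in> fib F (pr (\<gamma> t))) \<and>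
     (\<forall>(V, e)\<in>frames F. \<exists>f.
        (\<forall>i\<in>idx F. smooth_on {t. pr (\<gamma> t) \<in> V} (f i)) \<and>
        (\<forall>t. pr (\<gamma> t) \<in> V \<longrightarrow>
           \<xi> t = (\<Sum>i\<in>idx F. f i t *\<^sub>R e i (pr (\<gamma> t))) \<and>
           (\<Sum>i\<in>idx F. deriv (f i) t *\<^sub>R e i (pr (\<gamma> t)) +
              f i t *\<^sub>R D (e i) (pr (\<gamma> t)) (vector_derivative \<gamma> (at t))) = 0))"


section \<open>The exterior square\<close>

text \<open>The exterior square of a vector space embeds into the alternating bilinear forms on its
  dual. Forms are extended by \<open>0\<close> to arguments that are not linear functionals.\<close>

typedef (overloaded) 'v bivector =
  "{w :: ('v::real_vector \<Rightarrow> real) \<Rightarrow> ('v \<Rightarrow> real) \<Rightarrow> real.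
      (\<forall>\<alpha> \<beta>. \<not> (linear \<alpha> \<and> linear \<beta>) \<longrightarrow> w \<alpha> \<beta> = 0) \<and>
      (\<forall>\<alpha>. w \<alpha> \<alpha> = 0) \<and>
      (\<forall>\<alpha> \<beta> \<gamma> c. linear \<alpha> \<and> linear \<beta> \<and> linear \<gamma> \<longrightarrow>
         w (\<lambda>x. c * \<alpha> x + \<beta> x) \<gamma> = c * w \<alpha> \<gamma> + w \<beta> \<gamma> \<and>
         w \<gamma> (\<lambda>x. c * \<alpha> x + \<beta> x) = c * w \<gamma> \<alpha> + w \<gamma> \<beta>)}"
  by (rule exI[of _ "\<lambda>_ _. 0"]) simp

setup_lifting type_definition_bivector

instantiation bivector :: (real_vector) real_vector
begin

lift_definition zero_bivector :: "'a bivector" is "\<lambda>_ _. 0" by simp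

lift_definition plus_bivector :: "'a bivector \<Rightarrow> 'a bivector \<Rightarrow> 'a bivector"
  is "\<lambda>v w \<alpha> \<beta>. v \<alpha> \<beta> + w \<alpha> \<beta>"
  by (simp add: algebra_simps)

lift_definition uminus_bivector :: "'a bivector \<Rightarrow> 'a bivector"
  is "\<lambda>v \<alpha> \<beta>. - v \<alpha> \<beta>"
  by (simp add: algebra_simps)

lift_definition minus_bivector :: "'a bivector \<Rightarrow> 'a bivector \<Rightarrow> 'a bivector"
  is "\<lambda>v w \<alpha> \<beta>. v \<alpha> \<beta> - w \<alpha> \<beta>"
  by (simp add: algebra_simps)

lift_definition scaleR_bivector :: "real \<Rightarrow> 'a bivector \<Rightarrow> 'a bivector"
  is "\<lambda>r v \<alpha> \<beta>. r * v \<alpha> \<beta>"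
  by (simp add: algebra_simps)

instance
  by standard (transfer; simp add: fun_eq_iff algebra_simps)+

end

lemma linear_comb:
  fixes \<alpha> \<beta> :: "'v::real_vector \<Rightarrow> real"
  assumes "linear \<alpha>" "linear \<beta>"
  shows "linear (\<lambda>x. c * \<alpha> x + \<beta> x)"
  using assms by (auto intro!: linearI simp: linear_add linear_scale algebra_simps)

lift_definition wedge :: "'v::real_vector \<Rightarrow> 'v \<Rightarrow> 'v bivector" (infixl "\<and>\<^sub>V" 67)
  is "\<lambda>u v \<alpha> \<beta>. if linear \<alpha> \<and> linear \<beta> then \<alpha> u * \<beta> v - \<beta> u * \<alpha> v else 0"
  by (auto simp: linear_comb) (simp_all add: algebra_simps)

definition Ext2 :: "('i::linorder, 'v::real_vector) vbundle \<Rightarrow> ('i \<times> 'i, 'v bivector) vbundle" where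
  "Ext2 E = \<lparr>
     fib = (\<lambda>p. span {u \<and>\<^sub>V v | u v. u \<in> fib E p \<and> v \<in> fib E p}),
     idx = {(i, j). i \<in> idx E \<and> j \<in> idx E \<and> i < j},
     frames = {(U, \<lambda>(i, j) p. e i p \<and>\<^sub>V e j p) | U e. (U, e) \<in> frames E} \<rparr>"

definition induced_metric ::
  "('i::linorder, 'v::real_vector) vbundle \<Rightarrow> (torus \<Rightarrow> 'v \<Rightarrow> 'v \<Rightarrow> real) \<Rightarrow>
     (torus \<Rightarrow> 'v bivector \<Rightarrow> 'v bivector \<Rightarrow> real) \<Rightarrow> bool" where
  "induced_metric E h hh \<longleftrightarrow>
     bundle_metric (Ext2 E) hh \<and>
     (\<forall>p. \<forall>u\<in>fib E p. \<forall>v\<in>fib E p. \<forall>u'\<in>fib E p. \<forall>v'\<in>fib E p.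
        hh p (u \<and>\<^sub>V v) (u' \<and>\<^sub>V v') = h p u u' * h p v v' - h p u v' * h p v u')"

definition induced_connection ::
  "('i::linorder, 'v::real_vector) vbundle \<Rightarrow> ((torus \<Rightarrow> 'v) \<Rightarrow> torus \<Rightarrow> real \<times> real \<Rightarrow> 'v) \<Rightarrow>
     ((torus \<Rightarrow> 'v bivector) \<Rightarrow> torus \<Rightarrow> real \<times> real \<Rightarrow> 'v bivector) \<Rightarrow> bool" where
  "induced_connection E D DD \<longleftrightarrow>
     connection (Ext2 E) DD \<and>
     (\<forall>U s t. open U \<and> smooth_section E U s \<and> smooth_section E U t \<longrightarrow>
        (\<forall>p\<in>U. \<forall>w. DD (\<lambda>q. s q \<and>\<^sub>V t q) p w = D s p w \<and>\<^sub>V t p + s p \<and>\<^sub>V D t p w))"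

text \<open>The sign \<open>\<epsilon>\<close> is the real number \<open>1\<close> or \<open>-1\<close>. In the index type \<open>4\<close> (and likewise \<open>3\<close>),
  the four elements are \<open>1, 2, 3\<close> and \<open>4 = 0\<close>; they only serve as labels.\<close>

definition Omega :: "real \<Rightarrow> (4 \<Rightarrow> 'v::real_vector) \<Rightarrow> 3 \<Rightarrow> 'v bivector" where
  "Omega \<epsilon> e k = (1 / sqrt 2) *\<^sub>R
     (if k = 1 then e 1 \<and>\<^sub>V e 2 + \<epsilon> *\<^sub>R (e 3 \<and>\<^sub>V e 4)
      else if k = 2 then e 1 \<and>\<^sub>V e 3 + \<epsilon> *\<^sub>R (e 4 \<and>\<^sub>V e 2)
      else e 1 \<and>\<^sub>V e 4 + \<epsilon> *\<^sub>R (e 2 \<and>\<^sub>V e 3))"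

definition Ext2_half ::
  "real \<Rightarrow> (4, 'v::real_vector) vbundle \<Rightarrow> (torus \<Rightarrow> 'v \<Rightarrow> 'v \<Rightarrow> real) \<Rightarrow>
     (3, 'v bivector) vbundle" where
  "Ext2_half \<epsilon> E h = \<lparr>
     fib = (\<lambda>p. span {Omega \<epsilon> b k | b k. oriented_orthonormal_basis E h p b}),
     idx = UNIV,
     frames = {(U, \<lambda>k p. Omega \<epsilon> (\<lambda>i. e i p) k) | U e. oriented_orthonormal_frame E h U e} \<rparr>"


section \<open>Rotations\<close>

definition SO3 :: "(real^3^3) monoid" where
  "SO3 = \<lparr> carrier = {A. rotation_matrix A}, mult = (**), one = mat 1 \<rparr>"

lemma group_SO3: "group SO3"
proof (rule groupI)
  fix A assume "A \<in> carrier SO3"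
  then have A: "orthogonal_matrix A" "det A = 1"
    by (auto simp: SO3_def rotation_matrix_def)
  then show "\<exists>B\<in>carrier SO3. B \<otimes>\<^bsub>SO3\<^esub> A = \<one>\<^bsub>SO3\<^esub>"
    by (intro bexI[of _ "transpose A"])
      (auto simp: SO3_def rotation_matrix_def orthogonal_matrix_def det_transpose)
qed (auto simp: SO3_def rotation_matrix_def orthogonal_matrix_mul det_mul orthogonal_matrix_id
       matrix_mul_assoc)

text \<open>In HOL-Algebra, elements of infinite order have \<open>group.ord\<close> equal to \<open>0\<close>.\<close>

definition rot_order :: "real^3^3 \<Rightarrow> enat" where
  "rot_order A = (if group.ord SO3 A = 0 then \<infinity> else enat (group.ord SO3 A))"

definition rotation_axis :: "real^3^3 \<Rightarrow> (real^3) set" where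
  "rotation_axis A = {v. A *v v = v}"

text \<open>For rotations other than the identity the axes are lines and the following value, in
  \<open>{0..pi/2}\<close>, does not depend on the unit vectors.\<close>

definition axis_angle :: "real^3^3 \<Rightarrow> real^3^3 \<Rightarrow> real" where
  "axis_angle A B = (THE \<phi>. \<exists>u\<in>rotation_axis A. \<exists>v\<in>rotation_axis B.
     norm u = 1 \<and> norm v = 1 \<and> \<phi> = arccos \<bar>u \<bullet> v\<bar>)"

text \<open>\<open>\<xi>\<close> is a triple of sections along a coordinate axis, and \<open>C\<close> acts on the row vector of these
  sections from the right.\<close>

definition holonomy_matrix :: "(3 \<Rightarrow> real \<Rightarrow> 'w::real_vector) \<Rightarrow> real^3^3 \<Rightarrow> bool" where
  "holonomy_matrix \<xi> C \<longleftrightarrow> C \<in> carrier SO3 \<and>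
     (\<forall>a i. \<xi> i (a + 2 * pi) = (\<Sum>j\<in>UNIV. C $ j $ i *\<^sub>R \<xi> j a))"

definition topological_holonomy_group :: "real^3^3 \<Rightarrow> real^3^3 \<Rightarrow> (real^3^3) set" where
  "topological_holonomy_group C1 C2 = generate SO3 {C1, C2}"

end

theory Submission
  imports Defs
begin

text \<open>
  The holonomy matrices \<open>C1\<close> and \<open>C2\<close> are rotations, and the argument takes place in the subgroup
  that they generate. Call \<open>A\<close> the one of order \<open>2\<close>, a half-turn, and \<open>B\<close> the one of infinite order.
  The required pair is \<open>B\<close> and its conjugate \<open>A ** B ** A\<close>, which again has infinite order, so that
  only noncommutativity is at stake.

  Let \<open>u\<close> span the axis of \<open>B\<close>, so that \<open>A *v u\<close> spans the axis of the conjugate. If the two rotations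
  commute, then \<open>B\<close> preserves the line through \<open>A *v u\<close> and acts on it by a sign. The sign \<open>-1\<close> is
  excluded because \<open>B ** B\<close> would then fix two independent vectors and hence be the identity. With
  the sign \<open>1\<close>, \<open>A *v u\<close> lies on the axis of \<open>B\<close>, that is, \<open>A *v u = u\<close> or \<open>A *v u = - u\<close>. As \<open>A\<close> is a
  half-turn, the axes are then parallel in the first case and orthogonal in the second, and both
  are excluded by the hypothesis on the angle (\<open>rotation_not_commuting_with_halfturn_conjugate\<close>).
\<close>

section \<open>Axes of rotations\<close>

lemma rotation_matrix_inner:
  fixes R :: "real^'n^'n"
  assumes "rotation_matrix R"
  shows "(R *v x) \<bullet> (R *v y) = x \<bullet> y"
  using assms
  by (metis dot_lmul_matrix matrix_vector_mul_assoc matrix_vector_mul_lid orthogonal_matrix_def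
      rotation_matrix_def transpose_matrix_vector vector_transpose_matrix)

text \<open>A rotation fixing \<open>x\<close> and \<open>y\<close> also fixes their cross product. Since it preserves inner
  products, every displacement \<open>R *v w - w\<close> is orthogonal to all fixed vectors, hence to \<open>x\<close>, \<open>y\<close>
  and \<open>cross3 x y\<close>, which together span the space.\<close>

lemma rotation_fixing_independent_pair:
  fixes R :: "real^3^3"
  assumes R: "rotation_matrix R" and x: "R *v x = x" and y: "R *v y = y"
    and indep: "cross3 x y \<noteq> 0"
  shows "R = mat 1"
proof -
  have z: "R *v cross3 x y = cross3 x y"
    using cross_rotation_matrix[OF R, of x y] x y by simp
  have "R *v w = w" for w
  proof -
    define d where "d = R *v w - w"
    have orth: "d \<bullet> v = 0" if "R *v v = v" for v
      using rotation_matrix_inner[OF R, of w v] that by (simp add: d_def inner_diff_left)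
    have "cross3 d (cross3 x y) = (d \<bullet> y) *\<^sub>R x - (d \<bullet> x) *\<^sub>R y"
      by (rule Lagrange)
    then have "cross3 d (cross3 x y) = 0"
      using orth[OF x] orth[OF y] by simp
    then have "d = 0"
      using norm_and_cross_eq_0[of d "cross3 x y"] orth[OF z] indep by blast
    then show ?thesis by (simp add: d_def)
  qed
  then show ?thesis
    by (simp add: matrix_eq)
qed

lemma rotation_axis_one_dimensional:
  fixes R :: "real^3^3"
  assumes R: "rotation_matrix R" "R \<noteq> mat 1"
    and u: "R *v u = u" "norm u = 1" and x: "R *v x = x"
  shows "x = (u \<bullet> x) *\<^sub>R u"
proof -
  have "cross3 u x = 0"
    using rotation_fixing_independent_pair[OF R(1) u(1) x] R(2) by blast
  moreover have "cross3 u (cross3 u x) = (u \<bullet> x) *\<^sub>R u - (u \<bullet> u) *\<^sub>R x"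
    by (rule Lagrange)
  ultimately show ?thesis
    using u(2) by (simp add: dot_square_norm)
qed

text \<open>For a rotation \<open>R\<close>, the identity \<open>R - 1 = R ** (1 - transpose R)\<close> gives
  \<open>det (R - 1) = det (1 - R) = - det (R - 1)\<close>; the last sign is due to the odd dimension.\<close>

lemma rotation_has_unit_axis_vector:
  fixes R :: "real^3^3"
  assumes R: "rotation_matrix R"
  obtains u where "R *v u = u" "norm u = 1"
proof -
  have "R - mat 1 = R ** transpose (mat 1 - R)"
    using R by (simp add: rotation_matrix_def orthogonal_matrix_def transpose_def mat_def
        matrix_matrix_mult_def vec_eq_iff forall_3 sum_3 algebra_simps)
  then have "det (R - mat 1) = det (mat 1 - R)"
    using R by (metis det_mul det_transpose mult_1 rotation_matrix_def)
  moreover have "det (mat 1 - R) = - det (R - mat 1)"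
    by (simp add: det_3 algebra_simps)
  ultimately have "det (R - mat 1) = 0" by simp
  then obtain x where x: "x \<noteq> 0" "(R - mat 1) *v x = 0"
    using invertible_det_nz[of "R - mat 1"] invertible_left_inverse[of "R - mat 1"]
      matrix_left_invertible_ker[of "R - mat 1"] by blast
  then have "R *v x = x"
    by (simp add: matrix_vector_mult_diff_rdistrib)
  then show thesis
    using x(1) by (intro that[of "x /\<^sub>R norm x"]) (simp_all add: matrix_vector_mult_scaleR)
qed

text \<open>The definite description is well-behaved because unit vectors on an axis are determined up
  to sign, which the absolute value absorbs.\<close>

lemma axis_angle_eq:
  assumes A: "rotation_matrix A" "A \<noteq> mat 1" and B: "rotation_matrix B" "B \<noteq> mat 1"
    and v: "A *v v = v" "norm v = 1" and u: "B *v u = u" "norm u = 1"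
  shows "axis_angle A B = arccos \<bar>v \<bullet> u\<bar>"
  unfolding axis_angle_def
proof (rule the_equality)
  show "\<exists>u'\<in>rotation_axis A. \<exists>v'\<in>rotation_axis B.
      norm u' = 1 \<and> norm v' = 1 \<and> arccos \<bar>v \<bullet> u\<bar> = arccos \<bar>u' \<bullet> v'\<bar>"
    using v u by (auto simp: rotation_axis_def)
next
  fix \<phi>
  assume "\<exists>v'\<in>rotation_axis A. \<exists>u'\<in>rotation_axis B.
      norm v' = 1 \<and> norm u' = 1 \<and> \<phi> = arccos \<bar>v' \<bullet> u'\<bar>"
  then obtain v' u' where *: "A *v v' = v'" "B *v u' = u'" "norm v' = 1" "norm u' = 1"
    and \<phi>: "\<phi> = arccos \<bar>v' \<bullet> u'\<bar>"
    by (auto simp: rotation_axis_def)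
  have v': "v' = (v \<bullet> v') *\<^sub>R v" and u': "u' = (u \<bullet> u') *\<^sub>R u"
    using rotation_axis_one_dimensional[OF A v *(1)] rotation_axis_one_dimensional[OF B u *(2)]
    by auto
  have "\<bar>v \<bullet> v'\<bar> = 1" "\<bar>u \<bullet> u'\<bar> = 1"
    using arg_cong[OF v', of norm] arg_cong[OF u', of norm] * v u by simp_all
  moreover have "v' \<bullet> u' = (v \<bullet> v') * (u \<bullet> u') * (v \<bullet> u)"
    by (subst v', subst u') simp
  ultimately show "\<phi> = arccos \<bar>v \<bullet> u\<bar>"
    by (simp add: \<phi> abs_mult)
qed

lemma axis_angle_commute: "axis_angle A B = axis_angle B A"
proof -
  have "(\<exists>u\<in>rotation_axis A. \<exists>v\<in>rotation_axis B. norm u = 1 \<and> norm v = 1 \<and> \<phi> = arccos \<bar>u \<bullet> v\<bar>) \<longleftrightarrow>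
    (\<exists>u\<in>rotation_axis B. \<exists>v\<in>rotation_axis A. norm u = 1 \<and> norm v = 1 \<and> \<phi> = arccos \<bar>u \<bullet> v\<bar>)" for \<phi>
    by (metis inner_commute)
  then show ?thesis
    unfolding axis_angle_def by simp
qed


section \<open>Conjugation by a half-turn\<close>

lemma rotation_not_commuting_with_halfturn_conjugate:
  fixes A B :: "real^3^3"
  assumes A: "rotation_matrix A" "A \<noteq> mat 1" "A ** A = mat 1"
    and B: "rotation_matrix B" "B ** B \<noteq> mat 1"
    and angle: "axis_angle A B \<in> {0<..<pi/2}"
  shows "B ** (A ** B ** A) \<noteq> (A ** B ** A) ** B"
proof
  assume comm: "B ** (A ** B ** A) = (A ** B ** A) ** B"
  have B1: "B \<noteq> mat 1"
    using B(2) by auto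
  have AA: "A *v (A *v x) = x" for x
    using A(3) by (simp add: matrix_vector_mul_assoc)
  have comm': "B *v (A *v (B *v (A *v x))) = A *v (B *v (A *v (B *v x)))" for x
    using arg_cong[OF comm, of "\<lambda>M. M *v x"] by (simp flip: matrix_vector_mul_assoc)
  have BB: "rotation_matrix (B ** B)"
    using B(1) by (simp add: rotation_matrix_def orthogonal_matrix_mul det_mul)
  obtain v where v: "A *v v = v" "norm v = 1"
    using rotation_has_unit_axis_vector[OF A(1)] .
  obtain u where u: "B *v u = u" "norm u = 1"
    using rotation_has_unit_axis_vector[OF B(1)] .
  have norm_preserving: "norm (R *v x) = norm x" if "rotation_matrix R" for R :: "real^3^3" and x
    using rotation_matrix_inner[OF that] by (simp add: norm_eq_sqrt_inner)
  have sign: "c = 1 \<or> c = -1" if "norm (c *\<^sub>R x) = 1" "norm x = 1" for c and x :: "real^3"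
    using that by auto
  have angle_eq: "axis_angle A B = arccos \<bar>v \<bullet> u\<bar>"
    by (rule axis_angle_eq[OF A(1,2) B(1) B1 v u])
  define w where "w = A *v u"
  have w1: "norm w = 1"
    unfolding w_def by (simp add: norm_preserving[OF A(1)] u)
  \<comment> \<open>Since \<open>B\<close> commutes with the conjugate, which fixes \<open>w\<close>, the conjugate also fixes \<open>B *v w\<close>;
    in other words, the image of \<open>B *v w\<close> under \<open>A\<close> lies on the axis of \<open>B\<close>.\<close>
  have "B *v (A *v (B *v w)) = A *v (B *v w)"
    using comm'[of u] by (simp add: w_def AA u)
  then obtain c where "A *v (B *v w) = c *\<^sub>R u"
    using rotation_axis_one_dimensional[OF B(1) B1 u] by blast
  then have Bw: "B *v w = c *\<^sub>R w"
    using AA[of "B *v w"] by (simp add: w_def matrix_vector_mult_scaleR)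
  moreover have "norm (B *v w) = 1"
    by (simp add: norm_preserving[OF B(1)] w1)
  ultimately consider "B *v w = w" | "B *v w = - w"
    using sign[of c w] w1 by auto
  then show False
  proof cases
    case 1
    have wu: "w = (u \<bullet> w) *\<^sub>R u"
      by (rule rotation_axis_one_dimensional[OF B(1) B1 u 1])
    then have "norm ((u \<bullet> w) *\<^sub>R u) = 1"
      using w1 by simp
    then have "u \<bullet> w = 1 \<or> u \<bullet> w = -1"
      using sign u(2) by blast
    then consider "A *v u = u" | "A *v u = - u"
      using wu unfolding w_def by (metis scaleR_minus1_left scaleR_one)
    then show False
    proof cases
      case 1
      have "u = (v \<bullet> u) *\<^sub>R v"
        by (rule rotation_axis_one_dimensional[OF A(1,2) v 1])
      then have "\<bar>v \<bullet> u\<bar> = 1"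
        using u(2) v(2) by (metis mult.right_neutral norm_scaleR)
      then show False
        using angle angle_eq by simp
    next
      case 2
      have "v \<bullet> u = 0"
        using rotation_matrix_inner[OF A(1), of v u] 2 v(1) by simp
      then show False
        using angle angle_eq by simp
    qed
  next
    case 2
    have "cross3 u w \<noteq> 0"
    proof
      assume "cross3 u w = 0"
      \<comment> \<open>\<open>u\<close> and \<open>w\<close> are eigenvectors for the eigenvalues \<open>1\<close> and \<open>-1\<close>, hence orthogonal.\<close>
      moreover have "u \<bullet> w = 0"
        using rotation_matrix_inner[OF B(1), of u w] 2 u(1) by simp
      ultimately show False
        using norm_and_cross_eq_0[of u w] u(2) w1 by auto
    qed
    moreover have "(B ** B) *v w = w"
      using 2 linear_neg[OF matrix_vector_mul_linear[of B], of w]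
      by (simp flip: matrix_vector_mul_assoc)
    moreover have "(B ** B) *v u = u"
      using u(1) by (simp flip: matrix_vector_mul_assoc)
    ultimately show False
      using rotation_fixing_independent_pair[OF BB] B(2) by blast
  qed
qed


section \<open>Orders\<close>

lemma (in group) ord_conjugate:
  assumes a: "a \<in> carrier G" and b: "b \<in> carrier G"
  shows "ord (a \<otimes> b \<otimes> inv a) = ord b"
proof -
  have pow: "(a \<otimes> b \<otimes> inv a) [^] n = a \<otimes> b [^] n \<otimes> inv a" for n :: nat
  proof (induction n)
    case (Suc n)
    have "a \<otimes> b [^] n \<otimes> inv a \<otimes> (a \<otimes> b \<otimes> inv a)
        = a \<otimes> b [^] n \<otimes> (inv a \<otimes> a) \<otimes> (b \<otimes> inv a)"
      using a b by (simp only: m_assoc inv_closed m_closed nat_pow_closed)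
    with Suc show ?case
      using a b by (simp add: m_assoc)
  qed (use a in simp)
  have "(a \<otimes> b \<otimes> inv a) [^] n = \<one> \<longleftrightarrow> b [^] n = \<one>" for n :: nat
  proof -
    have "a \<otimes> b [^] n \<otimes> inv a = \<one> \<longleftrightarrow> a \<otimes> b [^] n \<otimes> inv a = a \<otimes> inv a"
      using a by simp
    also have "\<dots> \<longleftrightarrow> a \<otimes> b [^] n = a"
      using a b by (intro right_cancel) simp_all
    also have "\<dots> \<longleftrightarrow> b [^] n = \<one>"
      using a b by simp
    finally show ?thesis
      by (simp only: pow)
  qed
  then show ?thesis
    using a b pow_eq_id[OF b] by (subst ord_unique) simp_all
qed

lemma SO3_simps [simp]:
  "A \<in> carrier SO3 \<longleftrightarrow> rotation_matrix A" "mult SO3 = (**)" "one SO3 = mat 1"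
  by (simp_all add: SO3_def)

lemma SO3_pow2: "A [^]\<^bsub>SO3\<^esub> (2::nat) = A ** A"
  by (simp add: numeral_2_eq_2 nat_pow_def)

lemma rotation_of_order_two:
  assumes "rotation_matrix A" "rot_order A = 2"
  shows "A \<noteq> mat 1" "A ** A = mat 1"
proof -
  interpret group SO3 by (rule group_SO3)
  have ord: "ord A = 2"
    using assms(2) by (simp add: rot_order_def numeral_eq_enat split: if_splits)
  show "A \<noteq> mat 1"
    using ord ord_id by auto
  show "A ** A = mat 1"
    using pow_ord_eq_1[of A] assms(1) ord by (simp add: SO3_pow2)
qed

lemma rotation_of_infinite_order_square:
  assumes "rotation_matrix B" "rot_order B = \<infinity>"
  shows "B ** B \<noteq> mat 1"
proof -
  interpret group SO3 by (rule group_SO3)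
  have "ord B = 0"
    using assms(2) by (simp add: rot_order_def split: if_splits)
  then show ?thesis
    using ord_eq_0[of B] assms(1) SO3_pow2[of B] by (metis SO3_simps(1,3) zero_neq_numeral)
qed

text \<open>A half-turn is its own inverse, so \<open>A ** B ** A\<close> is a conjugate of \<open>B\<close>.\<close>

lemma rot_order_halfturn_conjugate:
  assumes A: "rotation_matrix A" "A ** A = mat 1" and B: "rotation_matrix B"
  shows "rot_order (A ** B ** A) = rot_order B"
proof -
  interpret group SO3 by (rule group_SO3)
  have "inv\<^bsub>SO3\<^esub> A = A"
    using A by (intro inv_equality) simp_all
  then show ?thesis
    using ord_conjugate[of A B] A B by (simp add: rot_order_def)
qed

lemma halfturn_and_infinite_order_noncommuting_pair:
  assumes A: "rotation_matrix A" "rot_order A = 2"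
    and B: "rotation_matrix B" "rot_order B = \<infinity>"
    and angle: "axis_angle A B \<in> {0<..<pi/2}"
  shows "\<exists>P\<in>generate SO3 {A, B}. \<exists>Q\<in>generate SO3 {A, B}.
    P ** Q \<noteq> Q ** P \<and> rot_order P = \<infinity> \<and> rot_order P \<ge> rot_order Q \<and> rot_order Q \<ge> 3"
proof (intro bexI conjI)
  note A' = rotation_of_order_two[OF A]
  show "B ** (A ** B ** A) \<noteq> (A ** B ** A) ** B"
    using rotation_not_commuting_with_halfturn_conjugate[OF A(1) A' B(1)
        rotation_of_infinite_order_square[OF B] angle] .
  show "rot_order B = \<infinity>" by (rule B(2))
  show "rot_order (A ** B ** A) \<le> rot_order B" "3 \<le> rot_order (A ** B ** A)"
    using rot_order_halfturn_conjugate[OF A(1) A'(2) B(1)] B(2) by simp_all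
  show "B \<in> generate SO3 {A, B}"
    by (simp add: generate.incl)
  show "A ** B ** A \<in> generate SO3 {A, B}"
    using generate.eng[of _ SO3 "{A, B}"] generate.incl[of _ "{A, B}" SO3] by simp
qed


section \<open>The topological holonomy group\<close>

theorem proposition5p3:
  fixes E :: "(4, 'v::real_vector) vbundle"
    and h :: "torus \<Rightarrow> 'v \<Rightarrow> 'v \<Rightarrow> real"
    and hh :: "torus \<Rightarrow> 'v bivector \<Rightarrow> 'v bivector \<Rightarrow> real"
    and nabla :: "(torus \<Rightarrow> 'v) \<Rightarrow> torus \<Rightarrow> real \<times> real \<Rightarrow> 'v"
    and nablah :: "(torus \<Rightarrow> 'v bivector) \<Rightarrow> torus \<Rightarrow> real \<times> real \<Rightarrow> 'v bivector"
    and \<epsilon> :: real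
    and \<omega> :: "3 \<Rightarrow> 'v bivector"
    and \<xi>x \<xi>y :: "3 \<Rightarrow> real \<Rightarrow> 'v bivector"
    and C1 C2 :: "real^3^3"
  assumes "oriented_vector_bundle E"
    and "bundle_metric E h"
    and "metric_connection E h nabla"
    and "induced_metric E h hh"
    and "induced_connection E nabla nablah"
    and "\<epsilon> \<in> {1, -1}"
    and "oriented_orthonormal_basis (Ext2_half \<epsilon> E h) hh (pr (0, 0)) \<omega>"
    and "\<And>i. parallel_along (Ext2_half \<epsilon> E h) nablah (\<lambda>a. (a, 0)) (\<xi>x i)"
    and "\<And>i. \<xi>x i 0 = \<omega> i"
    and "\<And>i. parallel_along (Ext2_half \<epsilon> E h) nablah (\<lambda>b. (0, b)) (\<xi>y i)"
    and "\<And>i. \<xi>y i 0 = \<omega> i"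
    and "holonomy_matrix \<xi>x C1"
    and "holonomy_matrix \<xi>y C2"
    and "{rot_order C1, rot_order C2} = {2, \<infinity>}"
    and "axis_angle C1 C2 \<in> {0<..<pi/2}"
  shows "\<exists>Ch1\<in>topological_holonomy_group C1 C2. \<exists>Ch2\<in>topological_holonomy_group C1 C2.
    Ch1 ** Ch2 \<noteq> Ch2 ** Ch1 \<and>
    rot_order Ch1 = \<infinity> \<and> rot_order Ch1 \<ge> rot_order Ch2 \<and> rot_order Ch2 \<ge> 3"
proof -
  have rot: "rotation_matrix C1" "rotation_matrix C2"
    using assms(12,13) by (simp_all add: holonomy_matrix_def)
  from assms(14) consider "rot_order C1 = 2" "rot_order C2 = \<infinity>" | "rot_order C1 = \<infinity>" "rot_order C2 = 2"
    by (auto simp: doubleton_eq_iff)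
  then show ?thesis
  proof cases
    case 1
    show ?thesis
      unfolding topological_holonomy_group_def
      by (rule halfturn_and_infinite_order_noncommuting_pair[OF rot(1) 1(1) rot(2) 1(2) assms(15)])
  next
    case 2
    have "axis_angle C2 C1 \<in> {0<..<pi/2}"
      using assms(15) by (simp only: axis_angle_commute[of C2 C1])
    from halfturn_and_infinite_order_noncommuting_pair[OF rot(2) 2(2) rot(1) 2(1) this]
    show ?thesis
      unfolding topological_holonomy_group_def by (simp only: insert_commute)
  qed
qed

end
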